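(* Let $I$ be an index set, $a^1,\dots,a^n,b\in\mathbb{R}^I$ and $c\in\mathbb{R}^n$. For $y\in\mathbb{R}^I$ put $$OV(y)=\inf\Big\{\sum_{k=1}^n c_kx_k : x\in\mathbb{R}^n,\ \sum_{k=1}^n a^k(i)x_k\ge y(i)\ \text{ for all } i\in I\Big\}\in[-\infty,+\infty].$$ Suppose the program with right-hand side $b$ is feasible and bounded. Let $Y$ be a linear subspace of $\mathbb{R}^I$ with $U=\mathrm{span}(a^1,\dots,a^n,b)\subseteq Y$ and such that $$\hat Y=\{y\in Y : -\infty<OV(y)<\infty\}$$ is a vector space. Then the dual problem $\mathrm{DSILP}(\hat Y)$ is solvable (its optimal value is attained) and (SD) holds for the pair consisting of the primal problem (with right-hand side $b$) and $\mathrm{DSILP}(\hat Y)$.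
   Context: Feasible and bounded means the feasible set is nonempty and the optimal value is $>-\infty$; $OV(y)=+\infty$ if the program with right-hand side $y$ is infeasible. For a linear subspace $V\subseteq\mathbb{R}^I$ containing $a^1,\dots,a^n,b$, let $V'_+$ be the set of real linear functionals $\psi$ on $V$ with $\psi(y)\ge0$ for every $y\in V$ with $y(i)\ge0$ for all $i\in I$. $\mathrm{DSILP}(V)$ is the problem: maximize $\psi(b)$ over $\psi\in V'_+$ with $\psi(a^k)=c_k$ for $k=1,\dots,n$. (SD) holds for (primal, $\mathrm{DSILP}(V)$) if there exists $\psi^*\in V'_+$ with $\psi^*(a^k)=c_k$ for $k=1,\dots,n$ and $\psi^*(b)=OV(b)$. Under the hypotheses of the claim, $U\subseteq\hat Y$, so $\mathrm{DSILP}(\hat Y)$ makes sense. *)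

theory Defs
  imports "HOL-Analysis.Analysis" "HOL-Library.Function_Algebras"
begin

text \<open>
  Function_Algebras makes functions an additive group pointwise; the pointwise real
  scaling below makes the library's span and subspace available for them.
\<close>

instantiation "fun" :: (type, real_vector) real_vector
begin

definition scaleR_fun :: "real \<Rightarrow> ('a \<Rightarrow> 'b) \<Rightarrow> 'a \<Rightarrow> 'b"
  where "scaleR_fun r f = (\<lambda>x. r *\<^sub>R f x)"

instance
  by standard (simp_all add: scaleR_fun_def fun_eq_iff algebra_simps)

end

lemma scaleR_fun_apply [simp]: "(r *\<^sub>R f) x = r *\<^sub>R f x"
  by (simp add: scaleR_fun_def)

text \<open>
  The space of real families indexed by an arbitrary, possibly empty, set \<open>S\<close>. A family is
  represented by the function that extends it by zero outside \<open>S\<close>, so that the pointwise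
  operations on functions are those of the space. Euclidean \<open>n\<close>-space is
  \<open>coord_space {1..n}\<close>.
\<close>

definition coord_space :: "'s set \<Rightarrow> ('s \<Rightarrow> real) set"
  where "coord_space S = {y. \<forall>s. s \<notin> S \<longrightarrow> y s = 0}"

definition primal_feasible ::
    "'i set \<Rightarrow> nat \<Rightarrow> (nat \<Rightarrow> 'i \<Rightarrow> real) \<Rightarrow> ('i \<Rightarrow> real) \<Rightarrow> (nat \<Rightarrow> real) set"
  where "primal_feasible I n a y =
    {x \<in> coord_space {1..n}. \<forall>i\<in>I. (\<Sum>k=1..n. a k i * x k) \<ge> y i}"

text \<open>
  The infimum is taken in the extended reals, so it is \<open>\<infinity>\<close> for an infeasible program
  and \<open>-\<infinity>\<close> for an unbounded one.
\<close>

definition OV ::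
    "'i set \<Rightarrow> nat \<Rightarrow> (nat \<Rightarrow> 'i \<Rightarrow> real) \<Rightarrow> (nat \<Rightarrow> real) \<Rightarrow> ('i \<Rightarrow> real) \<Rightarrow> ereal"
  where "OV I n a c y = (INF x\<in>primal_feasible I n a y. ereal (\<Sum>k=1..n. c k * x k))"

definition feasible_bounded ::
    "'i set \<Rightarrow> nat \<Rightarrow> (nat \<Rightarrow> 'i \<Rightarrow> real) \<Rightarrow> (nat \<Rightarrow> real) \<Rightarrow> ('i \<Rightarrow> real) \<Rightarrow> bool"
  where "feasible_bounded I n a c y \<longleftrightarrow> primal_feasible I n a y \<noteq> {} \<and> OV I n a c y > -\<infinity>"

definition finite_value_set ::
    "'i set \<Rightarrow> nat \<Rightarrow> (nat \<Rightarrow> 'i \<Rightarrow> real) \<Rightarrow> (nat \<Rightarrow> real) \<Rightarrow> ('i \<Rightarrow> real) set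
      \<Rightarrow> ('i \<Rightarrow> real) set"
  where "finite_value_set I n a c Y = {y \<in> Y. -\<infinity> < OV I n a c y \<and> OV I n a c y < \<infinity>}"

text \<open>
  The library's \<open>linear\<close> speaks about maps on a whole type. A functional on the subspace
  \<open>V\<close> is represented by a function on the type of which only the values on \<open>V\<close> matter.
\<close>

definition linear_functional_on :: "('i \<Rightarrow> real) set \<Rightarrow> (('i \<Rightarrow> real) \<Rightarrow> real) \<Rightarrow> bool"
  where "linear_functional_on V \<psi> \<longleftrightarrow>
    (\<forall>y\<in>V. \<forall>z\<in>V. \<psi> (y + z) = \<psi> y + \<psi> z) \<and> (\<forall>r. \<forall>y\<in>V. \<psi> (r *\<^sub>R y) = r * \<psi> y)"

definition positive_dual ::
    "'i set \<Rightarrow> ('i \<Rightarrow> real) set \<Rightarrow> (('i \<Rightarrow> real) \<Rightarrow> real) set"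
  where "positive_dual I V =
    {\<psi>. linear_functional_on V \<psi> \<and> (\<forall>y\<in>V. (\<forall>i\<in>I. y i \<ge> 0) \<longrightarrow> \<psi> y \<ge> 0)}"

text \<open>
  The problem \<open>DSILP(V)\<close> is meant for subspaces \<open>V\<close> that contain \<open>b\<close> and all the \<open>a k\<close>.
\<close>

definition DSILP_feasible ::
    "'i set \<Rightarrow> nat \<Rightarrow> (nat \<Rightarrow> 'i \<Rightarrow> real) \<Rightarrow> (nat \<Rightarrow> real) \<Rightarrow> ('i \<Rightarrow> real) set
      \<Rightarrow> (('i \<Rightarrow> real) \<Rightarrow> real) set"
  where "DSILP_feasible I n a c V = {\<psi> \<in> positive_dual I V. \<forall>k\<in>{1..n}. \<psi> (a k) = c k}"

definition DSILP_value ::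
    "'i set \<Rightarrow> nat \<Rightarrow> (nat \<Rightarrow> 'i \<Rightarrow> real) \<Rightarrow> (nat \<Rightarrow> real) \<Rightarrow> ('i \<Rightarrow> real)
      \<Rightarrow> ('i \<Rightarrow> real) set \<Rightarrow> ereal"
  where "DSILP_value I n a c b V = (SUP \<psi>\<in>DSILP_feasible I n a c V. ereal (\<psi> b))"

definition DSILP_solvable ::
    "'i set \<Rightarrow> nat \<Rightarrow> (nat \<Rightarrow> 'i \<Rightarrow> real) \<Rightarrow> (nat \<Rightarrow> real) \<Rightarrow> ('i \<Rightarrow> real)
      \<Rightarrow> ('i \<Rightarrow> real) set \<Rightarrow> bool"
  where "DSILP_solvable I n a c b V \<longleftrightarrow>
    (\<exists>\<psi>\<in>DSILP_feasible I n a c V. ereal (\<psi> b) = DSILP_value I n a c b V)"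

definition strong_duality ::
    "'i set \<Rightarrow> nat \<Rightarrow> (nat \<Rightarrow> 'i \<Rightarrow> real) \<Rightarrow> (nat \<Rightarrow> real) \<Rightarrow> ('i \<Rightarrow> real)
      \<Rightarrow> ('i \<Rightarrow> real) set \<Rightarrow> bool"
  where "strong_duality I n a c b V \<longleftrightarrow>
    (\<exists>\<psi>\<in>DSILP_feasible I n a c V. ereal (\<psi> b) = OV I n a c b)"

end

theory Submission
  imports Defs
begin

text \<open>
  The value function \<open>OV\<close> is sublinear: feasible points for \<open>y\<close> and \<open>z\<close> add up to a feasible
  point for \<open>y + z\<close>, and feasible points scale with the right-hand side. On the subspace
  \<open>V\<close> of right-hand sides with finite value it is moreover real-valued, so the Hahn--Banach
  theorem (\<open>hahn_banach_support\<close>) gives a linear functional \<open>\<psi>\<close> that lies below \<open>OV\<close> on \<open>V\<close>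
  and touches it at \<open>b\<close>. Being dominated by \<open>OV\<close> is exactly what makes \<open>\<psi>\<close> dual feasible:
  if \<open>y \<ge> 0\<close>, the point \<open>0\<close> is feasible for \<open>- y\<close>, whence \<open>- \<psi> y \<le> OV (- y) \<le> 0\<close>; and since
  the \<open>k\<close>-th unit vector is feasible for \<open>a k\<close> and its negative for \<open>- a k\<close>, both
  \<open>\<psi> (a k) \<le> c k\<close> and \<open>- \<psi> (a k) \<le> - c k\<close>. Thus \<open>\<psi>\<close> proves strong duality, and by weak
  duality (\<open>weak_duality\<close>) no dual feasible functional does better at \<open>b\<close>, so \<open>\<psi>\<close> is optimal.

  These arguments need every \<open>a k\<close> to belong to \<open>V\<close>. As \<open>V\<close> contains \<open>0\<close>, the program with
  right-hand side \<open>0\<close> is bounded, so no direction of recession has negative cost; subtracting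
  the \<open>k\<close>-th unit vector from a feasible point for \<open>a k\<close> gives such a direction, and so
  \<open>OV (a k)\<close> is at least \<open>c k\<close>.

  The Hahn--Banach theorem is obtained from the fact that a pointwise minimal sublinear
  functional is linear; Zorn's lemma puts a minimal one below any given one.
\<close>

section \<open>Sublinear functionals and the Hahn--Banach theorem\<close>

definition sublinear :: "('v::real_vector \<Rightarrow> real) \<Rightarrow> bool"
  where "sublinear p \<longleftrightarrow>
    (\<forall>x y. p (x + y) \<le> p x + p y) \<and> (\<forall>r>0. \<forall>x. p (r *\<^sub>R x) = r * p x)"

lemma sublinear_add: "sublinear p \<Longrightarrow> p (x + y) \<le> p x + p y"
  by (simp add: sublinear_def)

lemma sublinear_zero:
  assumes "sublinear p"
  shows "p 0 = 0"
proof -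
  have "p (2 *\<^sub>R 0) = 2 * p 0"
    using assms unfolding sublinear_def by (metis zero_less_numeral)
  then show ?thesis by simp
qed

lemma sublinear_scale:
  assumes "sublinear p" and "r \<ge> 0"
  shows "p (r *\<^sub>R x) = r * p x"
proof (cases "r = 0")
  case True
  then show ?thesis using sublinear_zero[OF assms(1)] by simp
next
  case False
  then show ?thesis using assms by (simp add: sublinear_def)
qed

lemma sublinear_minus_ge:
  assumes "sublinear p"
  shows "- p (- x) \<le> p x"
  using sublinear_add[OF assms, of x "- x"] sublinear_zero[OF assms] by simp

text \<open>
  Three functionals below are infima: the value function, a directional perturbation of a
  sublinear functional, and the infimum of a chain of sublinear functionals. In each case the
  set \<open>S x\<close> of competing values is compatible with addition and scaling of \<open>x\<close> up to
  decreasing the value, and that is all that sublinearity of the infimum takes.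
\<close>

lemma sublinear_Inf:
  fixes S :: "'v::real_vector \<Rightarrow> real set"
  assumes ne: "\<And>x. S x \<noteq> {}" and bdd: "\<And>x. bdd_below (S x)"
    and add: "\<And>x y s t. s \<in> S x \<Longrightarrow> t \<in> S y \<Longrightarrow> \<exists>u\<in>S (x + y). u \<le> s + t"
    and scale: "\<And>x s r. s \<in> S x \<Longrightarrow> r > 0 \<Longrightarrow> \<exists>u\<in>S (r *\<^sub>R x). u \<le> r * s"
  shows "sublinear (\<lambda>x. Inf (S x))"
  unfolding sublinear_def
proof (intro conjI allI impI)
  fix x y
  have *: "Inf (S (x + y)) \<le> s + t" if "s \<in> S x" "t \<in> S y" for s t
    using add[OF that] cInf_lower[OF _ bdd] by (meson order_trans)
  have "Inf (S (x + y)) - t \<le> Inf (S x)" if "t \<in> S y" for t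
    by (rule cInf_greatest[OF ne]) (use * that in \<open>simp add: diff_le_eq\<close>)
  then have "Inf (S (x + y)) - Inf (S x) \<le> Inf (S y)"
    by (intro cInf_greatest[OF ne]) (simp add: algebra_simps)
  then show "Inf (S (x + y)) \<le> Inf (S x) + Inf (S y)" by simp
next
  fix r :: real and x
  assume r: "r > 0"
  have le: "Inf (S (r *\<^sub>R x)) \<le> r * Inf (S x)" if r: "r > 0" for r x
  proof -
    have "Inf (S (r *\<^sub>R x)) / r \<le> Inf (S x)"
    proof (rule cInf_greatest[OF ne])
      fix s assume "s \<in> S x"
      then have "Inf (S (r *\<^sub>R x)) \<le> r * s"
        using scale[OF _ r] cInf_lower[OF _ bdd] by (meson order_trans)
      then show "Inf (S (r *\<^sub>R x)) / r \<le> s" using r by (simp add: field_simps)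
    qed
    then show ?thesis using r by (simp add: field_simps)
  qed
  \<comment> \<open>The converse inequality is the same one for the inverse factor.\<close>
  have "Inf (S x) \<le> inverse r * Inf (S (r *\<^sub>R x))"
    using le[of "inverse r" "r *\<^sub>R x"] r by simp
  then have "r * Inf (S x) \<le> Inf (S (r *\<^sub>R x))" using r by (simp add: field_simps)
  with le[OF r] show "Inf (S (r *\<^sub>R x)) = r * Inf (S x)" by (meson antisym)
qed

text \<open>
  The functional \<open>x \<mapsto> inf {q (x + s z) - s q z | s \<ge> 0}\<close> lies below \<open>q\<close> (take \<open>s = 0\<close>) and is
  at most \<open>q 0 - q z = - q z\<close> at \<open>- z\<close> (take \<open>s = 1\<close>). It is finite because
  \<open>s q z = q (s z) \<le> q (x + s z) + q (- x)\<close>.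
\<close>

lemma sublinear_flatten_direction:
  assumes q: "sublinear q"
  shows "\<exists>r. sublinear r \<and> (\<forall>x. r x \<le> q x) \<and> r (- z) \<le> - q z"
proof -
  define S where "S x = {q (x + s *\<^sub>R z) - s * q z | s. s \<ge> 0}" for x
  have lb: "- q (- x) \<le> u" if "u \<in> S x" for u x
  proof -
    from that obtain s where s: "s \<ge> 0" and u: "u = q (x + s *\<^sub>R z) - s * q z"
      by (auto simp: S_def)
    have "s * q z = q ((x + s *\<^sub>R z) + - x)" using sublinear_scale[OF q s] by simp
    also have "\<dots> \<le> q (x + s *\<^sub>R z) + q (- x)" by (rule sublinear_add[OF q])
    finally show ?thesis by (simp add: u)
  qed
  have bdd: "bdd_below (S x)" for x
    using lb by (rule bdd_belowI)
  have memI: "q (x + s *\<^sub>R z) - s * q z \<in> S x" if "s \<ge> 0" for x s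
    using that by (auto simp: S_def)
  have "sublinear (\<lambda>x. Inf (S x))"
  proof (rule sublinear_Inf)
    show "S x \<noteq> {}" for x using memI[of 0] by auto
    show "bdd_below (S x)" for x by (rule bdd)
  next
    fix x y u v
    assume "u \<in> S x" "v \<in> S y"
    then obtain s t where s: "s \<ge> 0" "u = q (x + s *\<^sub>R z) - s * q z"
      and t: "t \<ge> 0" "v = q (y + t *\<^sub>R z) - t * q z"
      by (auto simp: S_def)
    have "q ((x + y) + (s + t) *\<^sub>R z) \<le> q (x + s *\<^sub>R z) + q (y + t *\<^sub>R z)"
      using sublinear_add[OF q, of "x + s *\<^sub>R z" "y + t *\<^sub>R z"] by (simp add: algebra_simps)
    then show "\<exists>w\<in>S (x + y). w \<le> u + v"
      using s t by (intro bexI[OF _ memI[of "s + t"]]) (auto simp: algebra_simps)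
  next
    fix x u and r :: real
    assume "u \<in> S x" and r: "r > 0"
    then obtain s where s: "s \<ge> 0" "u = q (x + s *\<^sub>R z) - s * q z"
      by (auto simp: S_def)
    have "q (r *\<^sub>R x + (r * s) *\<^sub>R z) = r * q (x + s *\<^sub>R z)"
      using sublinear_scale[OF q, of r "x + s *\<^sub>R z"] r by (simp add: algebra_simps)
    then show "\<exists>w\<in>S (r *\<^sub>R x). w \<le> r * u"
      using s r by (intro bexI[OF _ memI[of "r * s"]]) (simp_all add: right_diff_distrib)
  qed
  moreover have "Inf (S x) \<le> q x" for x
    using cInf_lower[OF memI[of 0 x] bdd] by simp
  moreover have "Inf (S (- z)) \<le> - q z"
    using cInf_lower[OF memI[of 1 "- z"] bdd] sublinear_zero[OF q] by simp
  ultimately show ?thesis by blast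
qed

lemma sublinear_odd_imp_linear:
  assumes q: "sublinear q" and odd: "\<And>z. q (- z) = - q z"
  shows "linear q"
proof (rule linearI)
  fix x y
  have "q x \<le> q (x + y) + q (- y)"
    using sublinear_add[OF q, of "x + y" "- y"] by simp
  then show "q (x + y) = q x + q y"
    using sublinear_add[OF q, of x y] odd[of y] by linarith
next
  fix r :: real and x
  show "q (r *\<^sub>R x) = r *\<^sub>R q x"
  proof (cases "r \<ge> 0")
    case True
    then show ?thesis using sublinear_scale[OF q] by simp
  next
    case False
    then have "q ((- r) *\<^sub>R x) = (- r) * q x" by (intro sublinear_scale[OF q]) simp
    then show ?thesis using odd[of "r *\<^sub>R x"] by simp
  qed
qed

text \<open>
  Minimality turns the flattening along any direction into an equality, so a minimal
  sublinear functional is odd and therefore linear.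
\<close>

lemma ex_linear_below_sublinear:
  fixes p :: "'v::real_vector \<Rightarrow> real"
  assumes p: "sublinear p"
  shows "\<exists>f. linear f \<and> (\<forall>x. f x \<le> p x)"
proof -
  define A where "A = {q. sublinear q \<and> (\<forall>x. q x \<le> p x)}"
  \<comment> \<open>Zorn's lemma yields maximal elements, so the pointwise order is reversed.\<close>
  let ?P = "\<lambda>q r :: 'v \<Rightarrow> real. \<forall>x. r x \<le> q x"
  have "\<exists>m\<in>A. \<forall>q\<in>A. ?P m q \<longrightarrow> q = m"
  proof (rule predicate_Zorn)
    show "partial_order_on A (relation_of ?P A)"
      by (rule partial_order_on_relation_ofI) (auto intro!: ext intro: order_trans antisym)
  next
    fix C assume C: "C \<in> Chains (relation_of ?P A)"
    then have CA: "q \<in> A" if "q \<in> C" for q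
      using that by (auto simp: Chains_def relation_of_def)
    have total: "(\<forall>x. q x \<le> r x) \<or> (\<forall>x. r x \<le> q x)" if "q \<in> C" "r \<in> C" for q r
      using C that by (auto simp: Chains_def relation_of_def)
    show "\<exists>u\<in>A. \<forall>q\<in>C. ?P q u"
    proof (cases "C = {}")
      case True
      then show ?thesis using p by (auto simp: A_def)
    next
      case False
      define S where "S x = (\<lambda>q. q x) ` C" for x
      have lb: "- p (- x) \<le> s" if s: "s \<in> S x" for s x
      proof -
        obtain q where q: "q \<in> C" "s = q x" using s by (auto simp: S_def)
        then have "sublinear q" "q (- x) \<le> p (- x)" using CA by (auto simp: A_def)
        then show ?thesis using sublinear_minus_ge[of q x] q by simp
      qed
      have bdd: "bdd_below (S x)" for x
        using lb by (rule bdd_belowI)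
      have "sublinear (\<lambda>x. Inf (S x))"
      proof (rule sublinear_Inf)
        show "S x \<noteq> {}" for x using False by (simp add: S_def)
        show "bdd_below (S x)" for x by (rule bdd)
      next
        fix x y s t
        assume "s \<in> S x" "t \<in> S y"
        then obtain q r where q: "q \<in> C" "s = q x" and r: "r \<in> C" "t = r y"
          by (auto simp: S_def)
        \<comment> \<open>The smaller of two members of the chain bounds the values of both.\<close>
        obtain m where m: "m \<in> C" "m x \<le> s" "m y \<le> t"
          using total[OF q(1) r(1)] q r by blast
        then have "m (x + y) \<le> s + t"
          using sublinear_add[of m x y] CA[of m] by (force simp: A_def)
        then show "\<exists>u\<in>S (x + y). u \<le> s + t" using m by (auto simp: S_def)
      next
        fix x s and r :: real
        assume "s \<in> S x" and r: "r > 0"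
        then obtain q where q: "q \<in> C" "s = q x" by (auto simp: S_def)
        then have "q (r *\<^sub>R x) = r * s"
          using sublinear_scale[of q r x] CA[of q] r by (force simp: A_def)
        moreover have "q (r *\<^sub>R x) \<in> S (r *\<^sub>R x)"
          unfolding S_def using q(1) by (rule imageI)
        ultimately show "\<exists>u\<in>S (r *\<^sub>R x). u \<le> r * s" by (metis order_refl)
      qed
      moreover have below: "Inf (S x) \<le> q x" if "q \<in> C" for q x
        by (rule cInf_lower[OF _ bdd]) (use that in \<open>auto simp: S_def\<close>)
      moreover have "Inf (S x) \<le> p x" for x
      proof -
        obtain q where "q \<in> C" using False by blast
        then have "Inf (S x) \<le> q x" "q x \<le> p x" using below CA by (auto simp: A_def)
        then show ?thesis by simp
      qed
      ultimately show ?thesis by (intro bexI[of _ "\<lambda>x. Inf (S x)"]) (auto simp: A_def)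
    qed
  qed
  then obtain m where mA: "m \<in> A" and minA: "\<forall>q\<in>A. (\<forall>x. q x \<le> m x) \<longrightarrow> q = m"
    by blast
  then have m: "sublinear m" "\<And>x. m x \<le> p x" by (auto simp: A_def)
  have min: "q = m" if "sublinear q" "\<And>x. q x \<le> m x" for q
    using minA that m(2) unfolding A_def by (blast intro: order_trans)
  have "m (- z) = - m z" for z
  proof (rule antisym)
    obtain r where "sublinear r" "\<forall>x. r x \<le> m x" "r (- z) \<le> - m z"
      using sublinear_flatten_direction[OF m(1)] by blast
    then show "m (- z) \<le> - m z" using min[of r] by auto
    show "- m z \<le> m (- z)" using sublinear_minus_ge[OF m(1), of "- z"] by simp
  qed
  then have "linear m" by (rule sublinear_odd_imp_linear[OF m(1)])
  then show ?thesis using m(2) by blast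
qed

text \<open>
  Flattening \<open>p\<close> along \<open>b\<close> beforehand forces every linear functional below it to satisfy
  \<open>f (- b) \<le> - p b\<close>, that is, to attain the bound \<open>p b\<close>.
\<close>

theorem hahn_banach_support:
  assumes p: "sublinear p"
  shows "\<exists>f. linear f \<and> (\<forall>x. f x \<le> p x) \<and> f b = p b"
proof -
  obtain q where q: "sublinear q" "\<forall>x. q x \<le> p x" "q (- b) \<le> - p b"
    using sublinear_flatten_direction[OF p] by blast
  obtain f where f: "linear f" "\<forall>x. f x \<le> q x"
    using ex_linear_below_sublinear[OF q(1)] by blast
  have le: "f x \<le> p x" for x using f q by (meson order_trans)
  have "- f b = f (- b)" using linear_neg[OF f(1)] by simp
  also have "\<dots> \<le> - p b" using f q by (meson order_trans)
  finally have "f b = p b" using le[of b] by simp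
  then show ?thesis using f(1) le by blast
qed

section \<open>The primal program\<close>

lemma primal_feasible_add:
  assumes "x \<in> primal_feasible I n a y" and "x' \<in> primal_feasible I n a y'"
  shows "x + x' \<in> primal_feasible I n a (y + y')"
  using assms
  by (auto simp: primal_feasible_def coord_space_def algebra_simps sum.distrib intro: add_mono)

lemma primal_feasible_scale:
  assumes "x \<in> primal_feasible I n a y" and "r \<ge> 0"
  shows "r *\<^sub>R x \<in> primal_feasible I n a (r *\<^sub>R y)"
proof -
  have "(\<Sum>k=1..n. a k i * (r * x k)) = r * (\<Sum>k=1..n. a k i * x k)" for i
    by (simp add: sum_distrib_left algebra_simps)
  then show ?thesis
    using assms by (auto simp: primal_feasible_def coord_space_def intro: mult_left_mono)
qed

lemma zero_primal_feasible:
  assumes "\<And>i. i \<in> I \<Longrightarrow> y i \<le> 0"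
  shows "0 \<in> primal_feasible I n a y"
  using assms by (simp add: primal_feasible_def coord_space_def)

lemma sum_times_unit:
  fixes f :: "nat \<Rightarrow> real"
  assumes "k \<in> {1..n}"
  shows "(\<Sum>j=1..n. f j * (r *\<^sub>R indicator {k}) j) = r * f k"
proof -
  have "(\<Sum>j=1..n. f j * (r *\<^sub>R indicator {k}) j) = (\<Sum>j=1..n. if j = k then r * f j else 0)"
    by (rule sum.cong) (auto simp: indicator_def)
  also have "\<dots> = r * f k"
    using assms by (subst sum.delta) auto
  finally show ?thesis .
qed

lemma unit_primal_feasible:
  assumes "k \<in> {1..n}"
  shows "r *\<^sub>R indicator {k} \<in> primal_feasible I n a (r *\<^sub>R a k)"
proof -
  have "r *\<^sub>R indicator {k} \<in> coord_space {1..n}"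
    using assms by (auto simp: coord_space_def)
  moreover have "(\<Sum>j=1..n. a j i * (r *\<^sub>R indicator {k}) j) = r * a k i" for i
    by (rule sum_times_unit[OF assms])
  ultimately show ?thesis by (simp add: primal_feasible_def)
qed

abbreviation cost :: "nat \<Rightarrow> (nat \<Rightarrow> real) \<Rightarrow> (nat \<Rightarrow> real) \<Rightarrow> real"
  where "cost n c x \<equiv> \<Sum>k=1..n. c k * x k"

lemma cost_add: "cost n c (x + y) = cost n c x + cost n c y"
  by (simp add: algebra_simps sum.distrib)

lemma cost_scale: "cost n c (r *\<^sub>R x) = r * cost n c x"
  by (simp add: sum_distrib_left algebra_simps)

lemma OV_le_cost:
  assumes "x \<in> primal_feasible I n a y"
  shows "OV I n a c y \<le> ereal (cost n c x)"
  unfolding OV_def by (rule INF_lower[OF assms])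

lemma OV_finite_eq_Inf:
  assumes "-\<infinity> < OV I n a c y" and "OV I n a c y < \<infinity>"
  shows "primal_feasible I n a y \<noteq> {}"
    and "bdd_below (cost n c ` primal_feasible I n a y)"
    and "OV I n a c y = ereal (Inf (cost n c ` primal_feasible I n a y))"
proof -
  show "primal_feasible I n a y \<noteq> {}"
    using assms(2) by (auto simp: OV_def top_ereal_def)
  obtain v where v: "OV I n a c y = ereal v"
    using assms by (cases "OV I n a c y") auto
  have "v \<le> cost n c x" if "x \<in> primal_feasible I n a y" for x
    using OV_le_cost[OF that, of c] v by simp
  then show "bdd_below (cost n c ` primal_feasible I n a y)"
    by (intro bdd_belowI[of _ v]) auto
  show "OV I n a c y = ereal (Inf (cost n c ` primal_feasible I n a y))"
    using v unfolding OV_def by (subst ereal_INF) auto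
qed

text \<open>
  If a feasible point for right-hand side \<open>0\<close> had negative cost, its multiples would drive the
  cost to \<open>-\<infinity>\<close>.
\<close>

lemma cost_nonneg_if_zero_bounded:
  assumes "-\<infinity> < OV I n a c 0" and x: "x \<in> primal_feasible I n a 0"
  shows "0 \<le> cost n c x"
proof (rule ccontr)
  assume neg: "\<not> 0 \<le> cost n c x"
  have "OV I n a c 0 \<le> 0"
    using OV_le_cost[OF zero_primal_feasible[of I 0 n a], of c] by (simp add: zero_ereal_def)
  then obtain v where v: "OV I n a c 0 = ereal v" "v \<le> 0"
    using assms(1) by (cases "OV I n a c 0") auto
  \<comment> \<open>This multiple of \<open>x\<close> has cost \<open>v - 1\<close>, below the optimal value \<open>v\<close>.\<close>
  define r where "r = (v - 1) / cost n c x"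
  have "r \<ge> 0" using neg v by (simp add: r_def divide_nonpos_neg)
  then have "r *\<^sub>R x \<in> primal_feasible I n a 0"
    using primal_feasible_scale[OF x] by simp
  then have "v \<le> r * cost n c x"
    using OV_le_cost[of "r *\<^sub>R x" I n a 0 c] v cost_scale[of c r x n] by simp
  then show False using neg by (simp add: r_def)
qed

lemma OV_column_finite:
  assumes "-\<infinity> < OV I n a c 0" and k: "k \<in> {1..n}"
  shows "-\<infinity> < OV I n a c (a k)" and "OV I n a c (a k) < \<infinity>"
proof -
  have "ereal (c k) \<le> OV I n a c (a k)"
    unfolding OV_def
  proof (rule INF_greatest)
    fix x assume x: "x \<in> primal_feasible I n a (a k)"
    have "x + (- 1) *\<^sub>R indicator {k} \<in> primal_feasible I n a (a k + (- 1) *\<^sub>R a k)"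
      by (rule primal_feasible_add[OF x unit_primal_feasible[OF k]])
    moreover have "a k + (- 1) *\<^sub>R a k = 0" by simp
    ultimately have "0 \<le> cost n c (x + (- 1) *\<^sub>R indicator {k})"
      by (intro cost_nonneg_if_zero_bounded[OF assms(1)]) (simp only:)
    then have "c k \<le> cost n c x"
      unfolding cost_add sum_times_unit[OF k] by simp
    then show "ereal (c k) \<le> ereal (cost n c x)" by simp
  qed
  then show "-\<infinity> < OV I n a c (a k)" by (cases "OV I n a c (a k)") auto
  have "OV I n a c (a k) \<le> ereal (c k)"
    using OV_le_cost[OF unit_primal_feasible[OF k, of 1 I a], of c]
    unfolding sum_times_unit[OF k] by simp
  then show "OV I n a c (a k) < \<infinity>" by (cases "OV I n a c (a k)") auto
qed

section \<open>Weak duality\<close>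

lemma sum_fun_apply: "(\<Sum>k\<in>A. f k) i = (\<Sum>k\<in>A. f k i)"
  by (induction A rule: infinite_finite_induct) auto

lemma linear_functional_on_sum:
  assumes \<psi>: "linear_functional_on V \<psi>" and V: "subspace V" and K: "finite K"
    and f: "\<And>k. k \<in> K \<Longrightarrow> f k \<in> V"
  shows "\<psi> (\<Sum>k\<in>K. r k *\<^sub>R f k) = (\<Sum>k\<in>K. r k * \<psi> (f k))"
  using K f
proof (induction K)
  case empty
  have "\<psi> (0 *\<^sub>R 0) = 0 * \<psi> 0"
    using \<psi> subspace_0[OF V] unfolding linear_functional_on_def by blast
  then have "\<psi> 0 = 0" by simp
  then show ?case by (simp only: sum.empty)
next
  case (insert k K)
  have "r k *\<^sub>R f k \<in> V" "(\<Sum>k\<in>K. r k *\<^sub>R f k) \<in> V"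
    using insert.prems V by (auto intro!: subspace_sum subspace_scale)
  then have "\<psi> (r k *\<^sub>R f k + (\<Sum>k\<in>K. r k *\<^sub>R f k)) = r k * \<psi> (f k) + \<psi> (\<Sum>k\<in>K. r k *\<^sub>R f k)"
    using \<psi> insert.prems unfolding linear_functional_on_def by (metis insertI1)
  then show ?case
    using insert by (simp only: sum.insert insert_iff simp_thms)
qed

text \<open>
  The slack \<open>\<Sum>k. x k a k - b\<close> of a feasible point \<open>x\<close> is a nonnegative element of \<open>V\<close>, so a
  dual feasible functional is nonnegative on it.
\<close>

lemma weak_duality:
  assumes \<psi>: "\<psi> \<in> DSILP_feasible I n a c V" and V: "subspace V"
    and a: "\<And>k. k \<in> {1..n} \<Longrightarrow> a k \<in> V" and b: "b \<in> V"
  shows "ereal (\<psi> b) \<le> OV I n a c b"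
  unfolding OV_def
proof (rule INF_greatest)
  fix x assume x: "x \<in> primal_feasible I n a b"
  have lin: "linear_functional_on V \<psi>" and col: "\<And>k. k \<in> {1..n} \<Longrightarrow> \<psi> (a k) = c k"
    and pos: "\<And>y. y \<in> V \<Longrightarrow> (\<And>i. i \<in> I \<Longrightarrow> y i \<ge> 0) \<Longrightarrow> \<psi> y \<ge> 0"
    using \<psi> by (auto simp: DSILP_feasible_def positive_dual_def)
  define s where "s = (\<Sum>k=1..n. x k *\<^sub>R a k)"
  have sV: "s \<in> V"
    unfolding s_def using a V by (auto intro!: subspace_sum subspace_scale)
  have "\<psi> s = (\<Sum>k=1..n. x k * \<psi> (a k))"
    unfolding s_def by (rule linear_functional_on_sum[OF lin V]) (use a in auto)
  also have "\<dots> = cost n c x"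
    by (rule sum.cong) (use col in auto)
  finally have \<psi>s: "\<psi> s = cost n c x" .
  have slack: "s - b \<in> V" using subspace_diff[OF V sV b] .
  have "0 \<le> (s - b) i" if "i \<in> I" for i
    using x that by (auto simp: s_def sum_fun_apply primal_feasible_def mult.commute)
  then have "0 \<le> \<psi> (s - b)" by (rule pos[OF slack])
  moreover have "\<psi> s = \<psi> (s - b) + \<psi> b"
    using lin slack b unfolding linear_functional_on_def by (metis diff_add_cancel)
  ultimately show "ereal (\<psi> b) \<le> ereal (cost n c x)" using \<psi>s by simp
qed

section \<open>Strong duality\<close>

text \<open>
  Composing \<open>OV\<close> with a linear projection \<open>\<pi>\<close> onto \<open>V\<close> makes it a sublinear functional on the
  whole space without changing it on \<open>V\<close>, so that the Hahn--Banach theorem for whole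
  spaces applies.
\<close>

lemma ex_linear_support_of_OV:
  assumes V: "subspace V"
    and fin: "\<And>y. y \<in> V \<Longrightarrow> -\<infinity> < OV I n a c y \<and> OV I n a c y < \<infinity>"
    and b: "b \<in> V"
  shows "\<exists>\<psi>. linear \<psi> \<and> (\<forall>y\<in>V. ereal (\<psi> y) \<le> OV I n a c y) \<and> ereal (\<psi> b) = OV I n a c b"
proof -
  obtain \<pi> :: "('a \<Rightarrow> real) \<Rightarrow> 'a \<Rightarrow> real"
    where \<pi>: "range \<pi> \<subseteq> V" "linear \<pi>" "\<forall>v\<in>V. \<pi> v = v"
    using linear_exists_left_inverse_on[OF linear_id V] by (auto simp: id_def)
  have \<pi>V: "\<pi> y \<in> V" for y using \<pi>(1) by auto
  define S where "S y = cost n c ` primal_feasible I n a (\<pi> y)" for y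
  have S: "S y \<noteq> {}" "bdd_below (S y)" "OV I n a c (\<pi> y) = ereal (Inf (S y))" for y
    using OV_finite_eq_Inf[of I n a c "\<pi> y"] fin[OF \<pi>V] unfolding S_def by auto
  have "sublinear (\<lambda>y. Inf (S y))"
  proof (rule sublinear_Inf)
    fix y z s t assume "s \<in> S y" "t \<in> S z"
    then obtain x x' where "x \<in> primal_feasible I n a (\<pi> y)" "s = cost n c x"
      "x' \<in> primal_feasible I n a (\<pi> z)" "t = cost n c x'"
      by (auto simp: S_def)
    then have "x + x' \<in> primal_feasible I n a (\<pi> (y + z))" "cost n c (x + x') = s + t"
      using primal_feasible_add[of x I n a "\<pi> y" x' "\<pi> z"]
      by (simp_all only: linear_add[OF \<pi>(2)] cost_add)
    then show "\<exists>u\<in>S (y + z). u \<le> s + t"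
      unfolding S_def by (intro bexI[OF _ imageI]) (simp_all only: order_refl)
  next
    fix y s and r :: real assume "s \<in> S y" "r > 0"
    then obtain x where "x \<in> primal_feasible I n a (\<pi> y)" "s = cost n c x"
      by (auto simp: S_def)
    then have "r *\<^sub>R x \<in> primal_feasible I n a (\<pi> (r *\<^sub>R y))" "cost n c (r *\<^sub>R x) = r * s"
      using primal_feasible_scale[of x I n a "\<pi> y" r] \<open>r > 0\<close>
      by (simp_all only: linear_scale[OF \<pi>(2)] cost_scale less_imp_le)
    then show "\<exists>u\<in>S (r *\<^sub>R y). u \<le> r * s"
      unfolding S_def by (intro bexI[OF _ imageI]) (simp_all only: order_refl)
  qed (use S in auto)
  then obtain \<psi> where "linear \<psi>" "\<forall>y. \<psi> y \<le> Inf (S y)" "\<psi> b = Inf (S b)"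
    using hahn_banach_support by blast
  then show ?thesis
    using S(3) \<pi>(3) b by (metis ereal_less_eq(3))
qed

text \<open>
  Each dual constraint comes from one explicit primal point: \<open>0\<close> for positivity, and
  plus or minus a unit vector for the two halves of \<open>\<psi> (a k) = c k\<close>.
\<close>

lemma linear_below_OV_DSILP_feasible:
  assumes lin: "linear \<psi>" and V: "subspace V"
    and le: "\<And>y. y \<in> V \<Longrightarrow> ereal (\<psi> y) \<le> OV I n a c y"
    and a: "\<And>k. k \<in> {1..n} \<Longrightarrow> a k \<in> V"
  shows "\<psi> \<in> DSILP_feasible I n a c V"
proof -
  have bound: "\<psi> y \<le> cost n c x" if "y \<in> V" "x \<in> primal_feasible I n a y" for x y
    using order_trans[OF le[OF that(1)] OV_le_cost[OF that(2)]] by simp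
  have "0 \<le> \<psi> y" if "y \<in> V" "\<And>i. i \<in> I \<Longrightarrow> 0 \<le> y i" for y
  proof -
    have "0 \<in> primal_feasible I n a (- y)"
      by (rule zero_primal_feasible) (use that in simp)
    then have "\<psi> (- y) \<le> 0"
      using bound[of "- y" 0] subspace_neg[OF V that(1)] by simp
    then show ?thesis using linear_neg[OF lin, of y] by simp
  qed
  moreover have "\<psi> (a k) = c k" if k: "k \<in> {1..n}" for k
  proof -
    have "r * \<psi> (a k) \<le> r * c k" for r
      using bound[OF subspace_scale[OF V a[OF k]] unit_primal_feasible[OF k]]
      unfolding sum_times_unit[OF k] linear_scale[OF lin] by simp
    from this[of 1] this[of "- 1"] show ?thesis by simp
  qed
  moreover have "linear_functional_on V \<psi>"
    using lin by (simp add: linear_functional_on_def linear_add linear_scale)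
  ultimately show ?thesis
    by (auto simp: DSILP_feasible_def positive_dual_def)
qed

theorem theorem5p5:
  fixes I :: "'i set" and n :: nat
    and a :: "nat \<Rightarrow> 'i \<Rightarrow> real" and b :: "'i \<Rightarrow> real" and c :: "nat \<Rightarrow> real"
    and Y :: "('i \<Rightarrow> real) set"
  assumes "\<And>k. k \<in> {1..n} \<Longrightarrow> a k \<in> coord_space I"
    and "b \<in> coord_space I"
    and "c \<in> coord_space {1..n}"
    and "feasible_bounded I n a c b"
    and "subspace Y" and "Y \<subseteq> coord_space I"
    and "span (a ` {1..n} \<union> {b}) \<subseteq> Y"
    and "subspace (finite_value_set I n a c Y)"
  shows "DSILP_solvable I n a c b (finite_value_set I n a c Y)
    \<and> strong_duality I n a c b (finite_value_set I n a c Y)"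
proof -
  define V where "V = finite_value_set I n a c Y"
  have V: "subspace V" using assms(8) by (simp add: V_def)
  have fin: "-\<infinity> < OV I n a c y \<and> OV I n a c y < \<infinity>" if "y \<in> V" for y
    using that by (simp add: V_def finite_value_set_def)
  have inY: "y \<in> Y" if "y \<in> a ` {1..n} \<union> {b}" for y
    using assms(7) span_base[OF that] by blast
  have aV: "a k \<in> V" if k: "k \<in> {1..n}" for k
    using OV_column_finite[of I n a c k] fin[OF subspace_0[OF V]] k inY
    by (simp add: V_def finite_value_set_def)
  obtain x where "x \<in> primal_feasible I n a b"
    using assms(4) by (auto simp: feasible_bounded_def)
  then have "OV I n a c b \<le> ereal (cost n c x)" by (rule OV_le_cost)
  then have "OV I n a c b < \<infinity>" by (cases "OV I n a c b") auto
  then have bV: "b \<in> V"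
    using assms(4) inY by (simp add: V_def finite_value_set_def feasible_bounded_def)
  obtain \<psi> where "linear \<psi>" and le: "\<And>y. y \<in> V \<Longrightarrow> ereal (\<psi> y) \<le> OV I n a c y"
    and eq: "ereal (\<psi> b) = OV I n a c b"
    using ex_linear_support_of_OV[OF V fin bV] by blast
  then have feas: "\<psi> \<in> DSILP_feasible I n a c V"
    using linear_below_OV_DSILP_feasible V aV by blast
  have "DSILP_value I n a c b V = ereal (\<psi> b)"
    unfolding DSILP_value_def
  proof (rule antisym)
    show "(SUP \<phi>\<in>DSILP_feasible I n a c V. ereal (\<phi> b)) \<le> ereal (\<psi> b)"
      unfolding eq by (rule SUP_least) (rule weak_duality[OF _ V aV bV])
  qed (rule SUP_upper[OF feas])
  then show ?thesis
    using feas eq unfolding DSILP_solvable_def strong_duality_def V_def[symmetric] by force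
qed

end
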